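(* Let $G$ be a finite simple unmixed graph such that $I_c(G)$ is not linearly presented. Then there are distinct minimal vertex covers $C_1,C_2$ of $G$ such that the induced subgraph $G'=G[C_1\triangle C_2]$ is an unmixed bipartite graph without isolated vertices which is not Cohen–Macaulay.
   Context: $G$ has vertices $t_1,\dots,t_s$, $S=K[t_1,\dots,t_s]$, $K$ a field. $G$ is unmixed if all minimal vertex covers (inclusion-minimal vertex sets meeting every edge) have equal size. $I_c(G)$ is generated by $\prod_{t_i\in C}t_i$ over minimal vertex covers $C$; a monomial ideal minimally generated by $u_1,\dots,u_r$ is linearly presented if all $u_i$ have the same degree and the kernel of $S^r\to S$, $e_i\mapsto u_i$, is generated by vectors with linear-form entries. $C_1\triangle C_2$ is the symmetric difference and $G[L]$ is the subgraph induced on $L$. A graph $H$ is Cohen–Macaulay if $R/I(H)$ is Cohen–Macaulay, where $R$ is the polynomial ring on $V(H)$ and $I(H)$ is generated by the products $tt'$ over edges $\{t,t'\}$ of $H$. *)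

theory Defs
  imports Main "HOL-Library.Poly_Mapping" "HOL-Library.Extended_Nat"
begin

definition simple_graph :: "'v set \<Rightarrow> 'v set set \<Rightarrow> bool" where
  "simple_graph V E \<longleftrightarrow> finite V \<and> (\<forall>e\<in>E. e \<subseteq> V \<and> card e = 2)"

definition vertex_cover :: "'v set \<Rightarrow> 'v set set \<Rightarrow> 'v set \<Rightarrow> bool" where
  "vertex_cover V E C \<longleftrightarrow> C \<subseteq> V \<and> (\<forall>e\<in>E. e \<inter> C \<noteq> {})"

definition min_vertex_cover :: "'v set \<Rightarrow> 'v set set \<Rightarrow> 'v set \<Rightarrow> bool" where
  "min_vertex_cover V E C \<longleftrightarrow> vertex_cover V E C \<and> (\<forall>D. D \<subset> C \<longrightarrow> \<not> vertex_cover V E D)"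

definition unmixed :: "'v set \<Rightarrow> 'v set set \<Rightarrow> bool" where
  "unmixed V E \<longleftrightarrow> (\<forall>C D. min_vertex_cover V E C \<longrightarrow> min_vertex_cover V E D \<longrightarrow> card C = card D)"

definition bipartite :: "'v set \<Rightarrow> 'v set set \<Rightarrow> bool" where
  "bipartite V E \<longleftrightarrow> (\<exists>A B. A \<union> B = V \<and> A \<inter> B = {} \<and> (\<forall>e\<in>E. e \<inter> A \<noteq> {} \<and> e \<inter> B \<noteq> {}))"

definition no_isolated_vertices :: "'v set \<Rightarrow> 'v set set \<Rightarrow> bool" where
  "no_isolated_vertices V E \<longleftrightarrow> (\<forall>v\<in>V. \<exists>e\<in>E. v \<in> e)"

definition induced_edges :: "'v set set \<Rightarrow> 'v set \<Rightarrow> 'v set set" where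
  "induced_edges E L = {e \<in> E. e \<subseteq> L}"

type_synonym ('v, 'k) mpoly = "('v \<Rightarrow>\<^sub>0 nat) \<Rightarrow>\<^sub>0 'k"

definition Var :: "'v \<Rightarrow> ('v, 'k::field) mpoly" where
  "Var v = Poly_Mapping.single (Poly_Mapping.single v 1) 1"

definition polys :: "'v set \<Rightarrow> ('v, 'k::field) mpoly set" where
  "polys W = {p. \<forall>m\<in>Poly_Mapping.keys p. Poly_Mapping.keys m \<subseteq> W}"

definition max_ideal :: "'v set \<Rightarrow> ('v, 'k::field) mpoly set" where
  "max_ideal W = {p \<in> polys W. Poly_Mapping.lookup p 0 = 0}"

definition ideal_gen :: "'v set \<Rightarrow> ('v, 'k::field) mpoly set \<Rightarrow> ('v, 'k) mpoly set" where
  "ideal_gen W A = {p. \<exists>F c. finite F \<and> F \<subseteq> A \<and> (\<forall>a\<in>F. c a \<in> polys W) \<and> p = (\<Sum>a\<in>F. c a * a)}"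

definition is_ideal :: "'v set \<Rightarrow> ('v, 'k::field) mpoly set \<Rightarrow> bool" where
  "is_ideal W I \<longleftrightarrow> I \<subseteq> polys W \<and> 0 \<in> I \<and> (\<forall>a\<in>I. \<forall>b\<in>I. a + b \<in> I)
     \<and> (\<forall>r\<in>polys W. \<forall>a\<in>I. r * a \<in> I)"

definition prime_ideal :: "'v set \<Rightarrow> ('v, 'k::field) mpoly set \<Rightarrow> bool" where
  "prime_ideal W P \<longleftrightarrow> is_ideal W P \<and> P \<noteq> polys W
     \<and> (\<forall>a\<in>polys W. \<forall>b\<in>polys W. a * b \<in> P \<longrightarrow> a \<in> P \<or> b \<in> P)"

definition krull_dim :: "'v set \<Rightarrow> ('v, 'k::field) mpoly set \<Rightarrow> enat" where
  "krull_dim W I = Sup {enat n | n. \<exists>Ps :: ('v, 'k) mpoly set list.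
      length Ps = Suc n \<and> (\<forall>P\<in>set Ps. prime_ideal W P \<and> I \<subseteq> P)
      \<and> (\<forall>i<n. Ps ! i \<subset> Ps ! Suc i)}"

definition regular_seq :: "'v set \<Rightarrow> ('v, 'k::field) mpoly set \<Rightarrow> ('v, 'k) mpoly list \<Rightarrow> bool" where
  "regular_seq W I fs \<longleftrightarrow> set fs \<subseteq> max_ideal W
     \<and> (\<forall>i<length fs. \<forall>g\<in>polys W.
          fs ! i * g \<in> ideal_gen W (I \<union> set (take i fs)) \<longrightarrow> g \<in> ideal_gen W (I \<union> set (take i fs)))
     \<and> ideal_gen W (I \<union> set fs) \<noteq> polys W"

definition depth :: "'v set \<Rightarrow> ('v, 'k::field) mpoly set \<Rightarrow> enat" where
  "depth W I = Sup {enat (length fs) | fs. regular_seq W I fs}"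

definition cohen_macaulay_quot :: "'v set \<Rightarrow> ('v, 'k::field) mpoly set \<Rightarrow> bool" where
  "cohen_macaulay_quot W I \<longleftrightarrow> depth W I = krull_dim W I"

definition edge_ideal :: "'v set \<Rightarrow> 'v set set \<Rightarrow> ('v, 'k::field) mpoly set" where
  "edge_ideal V E = ideal_gen V ((\<lambda>e. \<Prod>t\<in>e. Var t) ` E)"

definition cohen_macaulay_graph :: "'k::field itself \<Rightarrow> 'v set \<Rightarrow> 'v set set \<Rightarrow> bool" where
  "cohen_macaulay_graph _ V E \<longleftrightarrow> cohen_macaulay_quot V (edge_ideal V E :: ('v, 'k) mpoly set)"

definition total_deg :: "('v \<Rightarrow>\<^sub>0 nat) \<Rightarrow> nat" where
  "total_deg m = (\<Sum>x\<in>Poly_Mapping.keys m. Poly_Mapping.lookup m x)"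

definition linear_form :: "('v, 'k::field) mpoly \<Rightarrow> bool" where
  "linear_form p \<longleftrightarrow> (\<forall>m\<in>Poly_Mapping.keys p. total_deg m = 1)"

definition homogeneous_of_deg :: "nat \<Rightarrow> ('v, 'k::field) mpoly \<Rightarrow> bool" where
  "homogeneous_of_deg d p \<longleftrightarrow> (\<forall>m\<in>Poly_Mapping.keys p. total_deg m = d)"

text \<open>Linear presentation w.r.t. the family u_i (i \<in> Ix, Ix finite) of minimal generators,
  over S = polys W.  Elements of S^r are functions Ix \<rightarrow> S (zero outside Ix).\<close>
definition syzygies :: "'v set \<Rightarrow> 'i set \<Rightarrow> ('i \<Rightarrow> ('v, 'k::field) mpoly) \<Rightarrow> ('i \<Rightarrow> ('v, 'k) mpoly) set" where
  "syzygies W Ix u = {a. (\<forall>i. a i \<in> polys W) \<and> (\<forall>i. i \<notin> Ix \<longrightarrow> a i = 0) \<and> (\<Sum>i\<in>Ix. a i * u i) = 0}"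

definition module_span :: "'v set \<Rightarrow> ('i \<Rightarrow> ('v, 'k::field) mpoly) set \<Rightarrow> ('i \<Rightarrow> ('v, 'k) mpoly) set" where
  "module_span W L = {a. \<exists>F c. finite F \<and> F \<subseteq> L \<and> (\<forall>w\<in>F. c w \<in> polys W)
      \<and> a = (\<lambda>i. \<Sum>w\<in>F. c w * w i)}"

definition linearly_presented :: "'v set \<Rightarrow> 'i set \<Rightarrow> ('i \<Rightarrow> ('v, 'k::field) mpoly) \<Rightarrow> bool" where
  "linearly_presented W Ix u \<longleftrightarrow>
     (\<exists>d. \<forall>i\<in>Ix. homogeneous_of_deg d (u i) \<and> u i \<noteq> 0)
     \<and> (\<exists>L. L \<subseteq> syzygies W Ix u \<and> (\<forall>w\<in>L. \<forall>i. linear_form (w i))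
            \<and> syzygies W Ix u = module_span W L)"

text \<open>The cover ideal I_c(G) is minimally generated by the monomials \<Prod>_{t\<in>C} t for the
  minimal vertex covers C; we express "I_c(G) is linearly presented" via this generating family.\<close>
definition cover_ideal_linearly_presented :: "'k::field itself \<Rightarrow> 'v set \<Rightarrow> 'v set set \<Rightarrow> bool" where
  "cover_ideal_linearly_presented _ V E \<longleftrightarrow>
     linearly_presented V {C. min_vertex_cover V E C} (\<lambda>C. (\<Prod>t\<in>C. Var t) :: ('v, 'k) mpoly)"

end

theory Submission
  imports Defs
begin

text \<open>
  If any two minimal vertex covers \<open>C\<close>, \<open>D\<close> could be joined by a chain of minimal vertex covers inside
  \<open>C \<union> D\<close>, exchanging one vertex at a time, then every binomial syzygy would telescope into linear
  ones and the cover ideal would be linearly presented. So some pair cannot be joined; take such a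
  pair \<open>C1\<close>, \<open>C2\<close> with \<open>|C1 - C2|\<close> minimal. A minimal cover inside \<open>C1 \<union> C2\<close> must then contain
  \<open>C1 - C2\<close> or \<open>C2 - C1\<close>, which forces the graph induced on the symmetric difference to be the complete
  bipartite graph \<open>K\<^sub>n\<^sub>,\<^sub>n\<close> with \<open>n \<ge> 2\<close>. Its edge ring has dimension at least 2 but depth at most 1.
\<close>

section \<open>Polynomial rings\<close>

lemma keys_add_nat: "Poly_Mapping.keys (a + b) = Poly_Mapping.keys a \<union> Poly_Mapping.keys b"
  for a b :: "'v \<Rightarrow>\<^sub>0 nat"
  by (auto simp: in_keys_iff lookup_add)

lemma polys_0 [simp]: "0 \<in> polys W"
  and polys_1 [simp]: "1 \<in> polys W"
  by (simp_all add: polys_def)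

lemma polys_add [intro]: "p \<in> polys W \<Longrightarrow> q \<in> polys W \<Longrightarrow> p + q \<in> polys W"
  unfolding polys_def using keys_add[of p q] by blast

lemma polys_uminus [intro]: "p \<in> polys W \<Longrightarrow> - p \<in> polys W"
  unfolding polys_def by (simp add: in_keys_iff)

lemma polys_diff [intro]: "p \<in> polys W \<Longrightarrow> q \<in> polys W \<Longrightarrow> p - q \<in> polys W"
  using polys_add[of p W "- q"] polys_uminus[of q W] by simp

lemma polys_mult [intro]: "p \<in> polys W \<Longrightarrow> q \<in> polys W \<Longrightarrow> p * q \<in> polys W"
  unfolding polys_def using keys_mult[of p q] by (fastforce simp: keys_add_nat)

lemma polys_single [intro]: "Poly_Mapping.keys m \<subseteq> W \<Longrightarrow> Poly_Mapping.single m c \<in> polys W"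
  by (simp add: polys_def)

lemma polys_Var [intro]: "v \<in> W \<Longrightarrow> Var v \<in> polys W"
  unfolding Var_def by (rule polys_single) simp

lemma poly_mapping_sum_singles:
  "p = (\<Sum>m\<in>Poly_Mapping.keys p. Poly_Mapping.single m (Poly_Mapping.lookup p m))"
proof (rule poly_mapping_eqI)
  fix k
  show "Poly_Mapping.lookup p k =
    Poly_Mapping.lookup (\<Sum>m\<in>Poly_Mapping.keys p. Poly_Mapping.single m (Poly_Mapping.lookup p m)) k"
    by (simp add: lookup_sum lookup_single when_def in_keys_iff sum.If_cases)
qed

section \<open>Squarefree monomials and the domain property\<close>

text \<open>The exponent vector of the squarefree monomial with support \<open>C\<close>. For
  infinite \<open>C\<close> the sum collapses to 0, hence the finiteness assumptions below.\<close>

definition monom_of :: "'v set \<Rightarrow> ('v \<Rightarrow>\<^sub>0 nat)" where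
  "monom_of C = (\<Sum>t\<in>C. Poly_Mapping.single t 1)"

lemma lookup_monom_of:
  "finite C \<Longrightarrow> Poly_Mapping.lookup (monom_of C) t = (if t \<in> C then 1 else 0)"
  by (simp add: monom_of_def lookup_sum lookup_single when_def)

lemma prod_Var_eq: "finite C \<Longrightarrow> (\<Prod>t\<in>C. Var t) = Poly_Mapping.single (monom_of C) 1"
  by (induction C rule: finite_induct) (simp_all add: monom_of_def Var_def mult_single)

lemma keys_monom_of: "finite C \<Longrightarrow> Poly_Mapping.keys (monom_of C) = C"
  by (auto simp: in_keys_iff lookup_monom_of split: if_splits)

lemma total_deg_monom_of: "finite C \<Longrightarrow> total_deg (monom_of C) = card C"
  by (simp add: total_deg_def keys_monom_of lookup_monom_of)

text \<open>The type of variables carries no order, so the domain property is obtained by numbering the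
  finitely many variables and comparing leading monomials in the order of \<^typ>\<open>nat \<Rightarrow>\<^sub>0 nat\<close>.\<close>

lemma polys_no_zero_divisors:
  fixes p q :: "('v, 'k::field) mpoly"
  assumes W: "finite W" and pW: "p \<in> polys W" and qW: "q \<in> polys W" and "p \<noteq> 0" "q \<noteq> 0"
  shows "p * q \<noteq> 0"
proof -
  obtain \<phi> :: "'v \<Rightarrow> nat" where \<phi>: "inj_on \<phi> W"
    using finite_imp_inj_to_nat_seg[OF W] by blast
  define w :: "('v \<Rightarrow>\<^sub>0 nat) \<Rightarrow> (nat \<Rightarrow>\<^sub>0 nat)" where
    "w m = (\<Sum>v\<in>W. Poly_Mapping.single (\<phi> v) (Poly_Mapping.lookup m v))" for m
  have w_add: "w (a + b) = w a + w b" for a b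
    by (simp add: w_def lookup_add single_add sum.distrib)
  have w_lookup: "Poly_Mapping.lookup (w m) (\<phi> v) = Poly_Mapping.lookup m v" if "v \<in> W" for m v
  proof -
    have "Poly_Mapping.lookup (w m) (\<phi> v) =
        (\<Sum>u\<in>W. if u = v then Poly_Mapping.lookup m u else 0)"
      unfolding w_def lookup_sum lookup_single when_def
      by (rule sum.cong) (use \<phi> that in \<open>auto simp: inj_on_def\<close>)
    then show ?thesis using W that by simp
  qed
  have w_inj: "a = b" if "w a = w b" "Poly_Mapping.keys a \<subseteq> W" "Poly_Mapping.keys b \<subseteq> W" for a b
  proof (rule poly_mapping_eqI)
    fix v
    show "Poly_Mapping.lookup a v = Poly_Mapping.lookup b v"
    proof (cases "v \<in> W")
      case True then show ?thesis using w_lookup[of v a] w_lookup[of v b] that(1) by simp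
    next
      case False then show ?thesis using that(2,3) by (metis in_keys_iff subsetD)
    qed
  qed
  have max_key: "\<exists>m\<in>Poly_Mapping.keys r. \<forall>n\<in>Poly_Mapping.keys r. n \<noteq> m \<longrightarrow> w n < w m"
    if r: "r \<in> polys W" "r \<noteq> 0" for r :: "('v, 'k) mpoly"
  proof -
    have ne: "Poly_Mapping.keys r \<noteq> {}" using r(2) by (metis in_keys_iff empty_iff poly_mapping_eqI lookup_zero)
    then have "Max (w ` Poly_Mapping.keys r) \<in> w ` Poly_Mapping.keys r"
      by (intro Max_in) auto
    then obtain m where m: "m \<in> Poly_Mapping.keys r" "w m = Max (w ` Poly_Mapping.keys r)" by auto
    have "w n < w m" if n: "n \<in> Poly_Mapping.keys r" "n \<noteq> m" for n
    proof -
      have "w n \<le> w m" using m n by simp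
      moreover have "w n \<noteq> w m" using w_inj[of n m] n m r(1) by (auto simp: polys_def)
      ultimately show ?thesis by simp
    qed
    then show ?thesis using m(1) by blast
  qed
  obtain m where m: "m \<in> Poly_Mapping.keys p" "\<And>n. n \<in> Poly_Mapping.keys p \<Longrightarrow> n \<noteq> m \<Longrightarrow> w n < w m"
    using max_key[OF pW \<open>p \<noteq> 0\<close>] by blast
  obtain n where n: "n \<in> Poly_Mapping.keys q" "\<And>k. k \<in> Poly_Mapping.keys q \<Longrightarrow> k \<noteq> n \<Longrightarrow> w k < w n"
    using max_key[OF qW \<open>q \<noteq> 0\<close>] by blast
  define c d where "c = Poly_Mapping.lookup p m" and "d = Poly_Mapping.lookup q n"
  \<comment> \<open>The remainders after removing the leading terms. In p * q = lead(p) * lead(q) +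
    lead(p) * q' + p' * q the last two summands contain only monomials with \<open>w\<close>-value
    below that of \<open>m + n\<close>, so the leading coefficients multiply without
    interference.\<close>
  define p' q' where "p' = p - Poly_Mapping.single m c" and "q' = q - Poly_Mapping.single n d"
  have p': "w k < w m" if "k \<in> Poly_Mapping.keys p'" for k
    using that m(2)[of k] by (cases "k = m") (auto simp: p'_def c_def in_keys_iff lookup_minus lookup_single)
  have q': "w k < w n" if "k \<in> Poly_Mapping.keys q'" for k
    using that n(2)[of k] by (cases "k = n") (auto simp: q'_def d_def in_keys_iff lookup_minus lookup_single)
  have q_le: "w k \<le> w n" if "k \<in> Poly_Mapping.keys q" for k
    using n(2)[OF that] by (cases "k = n") auto
  have 1: "Poly_Mapping.lookup (Poly_Mapping.single m c * q') (m + n) = 0"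
  proof (rule ccontr)
    assume "Poly_Mapping.lookup (Poly_Mapping.single m c * q') (m + n) \<noteq> 0"
    then have "m + n \<in> Poly_Mapping.keys (Poly_Mapping.single m c * q')" by (simp add: in_keys_iff)
    then obtain k where "k \<in> Poly_Mapping.keys q'" "m + n = m + k"
      using keys_mult[of "Poly_Mapping.single m c" q'] by (auto split: if_splits)
    then show False using q' by fastforce
  qed
  have 2: "Poly_Mapping.lookup (p' * q) (m + n) = 0"
  proof (rule ccontr)
    assume "Poly_Mapping.lookup (p' * q) (m + n) \<noteq> 0"
    then have "m + n \<in> Poly_Mapping.keys (p' * q)" by (simp add: in_keys_iff)
    then obtain j k where "j \<in> Poly_Mapping.keys p'" "k \<in> Poly_Mapping.keys q" "m + n = j + k"
      using keys_mult[of p' q] by auto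
    then have "w j < w m" "w k \<le> w n" "w m + w n = w j + w k"
      using p' q_le w_add by metis+
    then show False by (metis add_less_le_mono less_irrefl)
  qed
  have "p * q = Poly_Mapping.single (m + n) (c * d) + Poly_Mapping.single m c * q' + p' * q"
    by (simp add: p'_def q'_def algebra_simps flip: mult_single)
  then have "Poly_Mapping.lookup (p * q) (m + n) = c * d"
    using 1 2 by (simp add: lookup_add)
  moreover have "c * d \<noteq> 0" using m(1) n(1) by (simp add: c_def d_def in_keys_iff)
  ultimately show ?thesis by force
qed

section \<open>Substituting zero for variables, and the resulting primes\<close>

text \<open>\<open>kill Q\<close> substitutes 0 for the variables in \<open>Q\<close>.\<close>

definition kill :: "'v set \<Rightarrow> ('v, 'k::field) mpoly \<Rightarrow> ('v, 'k) mpoly" where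
  "kill Q p = Poly_Mapping.mapp (\<lambda>m c. c when Poly_Mapping.keys m \<inter> Q = {}) p"

lemma lookup_kill:
  "Poly_Mapping.lookup (kill Q p) m =
     (if Poly_Mapping.keys m \<inter> Q = {} then Poly_Mapping.lookup p m else 0)"
  by (simp add: kill_def lookup_mapp when_def in_keys_iff)

lemma kill_0 [simp]: "kill Q 0 = 0"
  by (rule poly_mapping_eqI) (simp add: lookup_kill)

lemma kill_add: "kill Q (p + q) = kill Q p + kill Q q"
  by (rule poly_mapping_eqI) (simp add: lookup_kill lookup_add)

lemma kill_diff: "kill Q (p - q) = kill Q p - kill Q q"
  by (rule poly_mapping_eqI) (simp add: lookup_kill lookup_minus)

lemma kill_kill: "kill Q (kill R p) = kill (Q \<union> R) p"
  by (rule poly_mapping_eqI) (auto simp: lookup_kill)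

lemma kill_idem [simp]: "kill Q (kill Q p) = kill Q p"
  by (simp add: kill_kill)

lemma kill_polys [intro]: "p \<in> polys W \<Longrightarrow> kill Q p \<in> polys W"
  by (auto simp: polys_def in_keys_iff lookup_kill split: if_splits)

lemma kill_eq_self_iff: "kill Q p = p \<longleftrightarrow> (\<forall>m\<in>Poly_Mapping.keys p. Poly_Mapping.keys m \<inter> Q = {})"
  by (auto simp: poly_mapping_eq_iff fun_eq_iff lookup_kill in_keys_iff)

text \<open>Identifies the kernel of the substitution with the monomial ideal generated by the
  variables in \<open>Q\<close>: membership can be tested one monomial at a time.\<close>

lemma kill_eq_0_iff: "kill Q p = 0 \<longleftrightarrow> (\<forall>m\<in>Poly_Mapping.keys p. Poly_Mapping.keys m \<inter> Q \<noteq> {})"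
  by (auto simp: poly_mapping_eq_iff fun_eq_iff lookup_kill in_keys_iff)

text \<open>Exponents add without cancelling, so a product with a killed factor is killed and a
  product of survivors survives. Splitting each factor into its surviving and killed parts then
  gives multiplicativity.\<close>

lemma kill_mult: "kill Q (p * q) = kill Q p * kill Q q"
proof -
  have rest: "kill Q (r * s) = 0" if "kill Q r = 0" for r s :: "('a, 'b) mpoly"
    using that keys_mult[of r s] unfolding kill_eq_0_iff by (fastforce simp: keys_add_nat)
  have main: "kill Q (kill Q p * kill Q q) = kill Q p * kill Q q"
    unfolding kill_eq_self_iff
  proof
    fix m assume "m \<in> Poly_Mapping.keys (kill Q p * kill Q q)"
    then obtain a b where ab: "a \<in> Poly_Mapping.keys (kill Q p)" "b \<in> Poly_Mapping.keys (kill Q q)" "m = a + b"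
      using keys_mult[of "kill Q p" "kill Q q"] by blast
    have "kill Q (kill Q p) = kill Q p" "kill Q (kill Q q) = kill Q q" by (simp_all add: kill_kill)
    then show "Poly_Mapping.keys m \<inter> Q = {}"
      using ab unfolding kill_eq_self_iff by (auto simp: keys_add_nat)
  qed
  have "p * q = kill Q p * kill Q q + (p - kill Q p) * q + (q - kill Q q) * kill Q p"
    by (simp add: algebra_simps)
  then have "kill Q (p * q) = kill Q (kill Q p * kill Q q) + kill Q ((p - kill Q p) * q)
      + kill Q ((q - kill Q q) * kill Q p)"
    by (metis kill_add)
  then show ?thesis by (simp add: rest main kill_diff kill_kill)
qed

lemma kill_1 [simp]: "kill Q 1 = 1"
  by (simp add: kill_eq_self_iff)

lemma kill_Var: "kill Q (Var v) = (if v \<in> Q then 0 else Var v)"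
  by (simp add: Var_def kill_eq_self_iff kill_eq_0_iff)

lemma Var_neq_0 [simp]: "Var v \<noteq> (0 :: ('v, 'k::field) mpoly)"
  unfolding Var_def by (metis lookup_single_eq lookup_zero zero_neq_one)

lemma is_ideal_kill: "is_ideal W {p \<in> polys W. kill Q p = 0}"
  by (auto simp: is_ideal_def kill_add kill_mult)

text \<open>The ideal is the kernel of a ring endomorphism of a domain that fixes 1, hence
  prime.\<close>

lemma prime_ideal_kill:
  assumes "finite W"
  shows "prime_ideal W {p \<in> polys W. kill Q p = (0 :: ('v, 'k::field) mpoly)}"
proof -
  have "1 \<notin> {p \<in> polys W. kill Q p = (0 :: ('v, 'k) mpoly)}" by simp
  moreover have "kill Q a = 0 \<or> kill Q b = 0"
    if "a \<in> polys W" "b \<in> polys W" "kill Q (a * b) = 0" for a b :: "('v, 'k) mpoly"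
    using polys_no_zero_divisors[OF assms kill_polys[OF that(1)] kill_polys[OF that(2)]] that(3)
    by (metis kill_mult)
  ultimately show ?thesis
    unfolding prime_ideal_def using is_ideal_kill[of W Q] polys_1 by blast
qed

section \<open>Ideals generated by a set\<close>

lemma ideal_gen_superset: "a \<in> A \<Longrightarrow> r \<in> polys W \<Longrightarrow> r * a \<in> ideal_gen W A"
  unfolding ideal_gen_def by (auto intro!: exI[of _ "{a}"] exI[of _ "\<lambda>_. r"])

lemma ideal_gen_add:
  assumes "p \<in> ideal_gen W A" "q \<in> ideal_gen W A"
  shows "p + q \<in> ideal_gen W A"
proof -
  obtain F c where F: "finite F" "F \<subseteq> A" "\<forall>a\<in>F. c a \<in> polys W" "p = (\<Sum>a\<in>F. c a * a)"
    using assms(1) by (auto simp: ideal_gen_def)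
  obtain G d where G: "finite G" "G \<subseteq> A" "\<forall>a\<in>G. d a \<in> polys W" "q = (\<Sum>a\<in>G. d a * a)"
    using assms(2) by (auto simp: ideal_gen_def)
  define e where "e a = (if a \<in> F then c a else 0) + (if a \<in> G then d a else 0)" for a
  have "(\<Sum>a\<in>F. c a * a) = (\<Sum>a\<in>F \<union> G. (if a \<in> F then c a else 0) * a)"
    using F(1) G(1) by (intro sum.mono_neutral_cong_left) auto
  moreover have "(\<Sum>a\<in>G. d a * a) = (\<Sum>a\<in>F \<union> G. (if a \<in> G then d a else 0) * a)"
    using F(1) G(1) by (intro sum.mono_neutral_cong_left) auto
  ultimately have "p + q = (\<Sum>a\<in>F \<union> G. e a * a)"
    by (simp add: F(4) G(4) e_def distrib_right sum.distrib)
  moreover have "\<forall>a\<in>F \<union> G. e a \<in> polys W" using F(3) G(3) by (auto simp: e_def)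
  ultimately show ?thesis unfolding ideal_gen_def using F(1,2) G(1,2) by blast
qed

lemma ideal_gen_sum:
  "(\<And>i. i \<in> F \<Longrightarrow> f i \<in> ideal_gen W A) \<Longrightarrow> sum f F \<in> ideal_gen W A"
proof (induction F rule: infinite_finite_induct)
  case (insert x F)
  then show ?case by (simp add: ideal_gen_add)
qed (auto simp: ideal_gen_def intro: exI[of _ "{}"])

lemma ideal_gen_subset_ideal:
  assumes I: "is_ideal W I" and A: "A \<subseteq> I"
  shows "ideal_gen W A \<subseteq> I"
proof
  fix p assume "p \<in> ideal_gen W A"
  then obtain F c where F: "finite F" "F \<subseteq> A" "\<forall>a\<in>F. c a \<in> polys W" "p = (\<Sum>a\<in>F. c a * a)"
    by (auto simp: ideal_gen_def)
  have sum: "sum f F \<in> I" if "\<And>a. a \<in> F \<Longrightarrow> f a \<in> I" for f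
    using F(1) that I by (induction F rule: finite_induct) (auto simp: is_ideal_def)
  show "p \<in> I" unfolding F(4) by (rule sum) (use F A I in \<open>auto simp: is_ideal_def\<close>)
qed

lemma ideal_gen_ideal:
  assumes "is_ideal W I"
  shows "ideal_gen W I = I"
proof
  show "I \<subseteq> ideal_gen W I" using ideal_gen_superset[of _ I 1 W] by auto
qed (use ideal_gen_subset_ideal[OF assms] in auto)

text \<open>A normal form for I + (f): it lets a membership be unpacked into one equation, to which
  the substitutions \<open>kill\<close> can be applied.\<close>

lemma ideal_gen_insert_ideal:
  fixes f :: "('v, 'k::field) mpoly"
  assumes I: "is_ideal W I" and f: "f \<in> polys W"
  shows "ideal_gen W (I \<union> {f}) = {i + h * f | i h. i \<in> I \<and> h \<in> polys W}" (is "_ = ?J")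
proof
  have "is_ideal W ?J"
    unfolding is_ideal_def
  proof (intro conjI ballI)
    show "?J \<subseteq> polys W" using I f by (auto simp: is_ideal_def)
    show "0 \<in> ?J" using I by (auto simp: is_ideal_def intro!: exI[of _ 0])
  next
    fix a b assume "a \<in> ?J" "b \<in> ?J"
    then obtain i h j k where *: "a = i + h * f" "i \<in> I" "h \<in> polys W" "b = j + k * f" "j \<in> I" "k \<in> polys W"
      by blast
    have "a + b = (i + j) + (h + k) * f" using * by (simp add: algebra_simps)
    moreover have "i + j \<in> I" using * I by (simp add: is_ideal_def)
    moreover have "h + k \<in> polys W" using * by auto
    ultimately show "a + b \<in> ?J" by blast
  next
    fix r a :: "('v, 'k) mpoly" assume "r \<in> polys W" "a \<in> ?J"
    then obtain i h where *: "a = i + h * f" "i \<in> I" "h \<in> polys W" by blast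
    have "r * a = r * i + (r * h) * f" using * by (simp add: algebra_simps)
    moreover have "r * i \<in> I" using * I \<open>r \<in> polys W\<close> by (simp add: is_ideal_def)
    moreover have "r * h \<in> polys W" using * \<open>r \<in> polys W\<close> by auto
    ultimately show "r * a \<in> ?J" by blast
  qed
  moreover have "i + 0 * f \<in> ?J" if "i \<in> I" for i
    using that polys_0 by blast
  then have "I \<subseteq> ?J" by auto
  moreover have "0 + 1 * f \<in> ?J" using I polys_1 unfolding is_ideal_def by blast
  then have "f \<in> ?J" by simp
  ultimately show "ideal_gen W (I \<union> {f}) \<subseteq> ?J" by (intro ideal_gen_subset_ideal) auto
next
  show "?J \<subseteq> ideal_gen W (I \<union> {f})"
  proof
    fix p assume "p \<in> ?J"
    then obtain i h where *: "p = i + h * f" "i \<in> I" "h \<in> polys W" by blast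
    show "p \<in> ideal_gen W (I \<union> {f})"
      using ideal_gen_superset[of i "I \<union> {f}" 1 W] ideal_gen_superset[of f "I \<union> {f}" h W] *
      by (auto intro: ideal_gen_add)
  qed
qed

section \<open>Complete bipartite graphs\<close>

text \<open>A monomial killed by both substitutions involves some a in \<open>A\<close> and some b
  in \<open>B\<close>, so the edge monomial ab divides it. The edge ideal is thus the intersection
  of the primes (A) and (B), and membership reduces to two evaluations.\<close>

lemma edge_ideal_complete_bipartite:
  fixes A B :: "'v set" and E :: "'v set set"
  assumes dis: "A \<inter> B = {}"
    and E: "E = {{a, b} | a b. a \<in> A \<and> b \<in> B}"
  shows "(edge_ideal (A \<union> B) E :: ('v, 'k::field) mpoly set) =
    {p \<in> polys (A \<union> B). kill A p = 0 \<and> kill B p = 0}" (is "?I = ?J")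
proof
  have "is_ideal (A \<union> B) ?J" by (auto simp: is_ideal_def kill_add kill_mult)
  moreover have "(\<Prod>t\<in>e. Var t) \<in> ?J" if e: "e \<in> E" for e
  proof -
    obtain a b where ab: "e = {a, b}" "a \<in> A" "b \<in> B" using e unfolding E by blast
    then have "a \<noteq> b" using dis by auto
    then have "(\<Prod>t\<in>e. Var t) = (Var a * Var b :: ('v, 'k) mpoly)" using ab by simp
    then show ?thesis using ab by (auto simp: kill_mult kill_Var)
  qed
  ultimately show "?I \<subseteq> ?J" unfolding edge_ideal_def by (intro ideal_gen_subset_ideal) auto
next
  show "?J \<subseteq> ?I"
  proof
    fix p :: "('v, 'k) mpoly" assume p: "p \<in> ?J"
    have "Poly_Mapping.single m (Poly_Mapping.lookup p m) \<in> ?I" if m: "m \<in> Poly_Mapping.keys p" for m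
    proof -
      obtain a b where ab: "a \<in> A" "b \<in> B" "a \<in> Poly_Mapping.keys m" "b \<in> Poly_Mapping.keys m"
        using p m unfolding kill_eq_0_iff by blast
      have neq: "a \<noteq> b" using ab dis by auto
      \<comment> \<open>The exponent of the quotient of \<open>m\<close> by ab. The truncated
        subtraction is exact because \<open>a\<close> and \<open>b\<close> are distinct and both
        occur in \<open>m\<close>.\<close>
      define n where "n = m - (Poly_Mapping.single a 1 + Poly_Mapping.single b 1)"
      have mn: "m = n + (Poly_Mapping.single a 1 + Poly_Mapping.single b 1)"
        using ab neq by (intro poly_mapping_eqI)
          (auto simp: n_def lookup_add lookup_minus lookup_single when_def in_keys_iff)
      have "Poly_Mapping.keys m \<subseteq> A \<union> B" using p m by (auto simp: polys_def)
      then have "Poly_Mapping.keys n \<subseteq> A \<union> B" using mn by (simp add: keys_add_nat)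
      then have r: "Poly_Mapping.single n (Poly_Mapping.lookup p m) \<in> polys (A \<union> B)" by auto
      have "Poly_Mapping.single m (Poly_Mapping.lookup p m) =
          Poly_Mapping.single n (Poly_Mapping.lookup p m) * (\<Prod>t\<in>{a, b}. Var t)"
        using neq by (subst mn) (simp add: Var_def mult_single)
      then show ?thesis
        unfolding edge_ideal_def using E ab r by (auto intro!: ideal_gen_superset)
    qed
    then have "(\<Sum>m\<in>Poly_Mapping.keys p. Poly_Mapping.single m (Poly_Mapping.lookup p m)) \<in> ?I"
      unfolding edge_ideal_def by (rule ideal_gen_sum)
    then show "p \<in> ?I" using poly_mapping_sum_singles[of p] by simp
  qed
qed

text \<open>If \<open>f\<close> is a nonzerodivisor modulo the edge ideal \<open>I\<close>, then the part of \<open>f\<close> in the variables \<open>A\<close>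
  is a socle element modulo \<open>I + (f)\<close>, which leaves no room for a second element.\<close>

lemma regular_seq_complete_bipartite:
  fixes A B :: "'v set" and fs :: "('v, 'k::field) mpoly list"
  assumes fin: "finite A" "finite B" and ne: "A \<noteq> {}" "B \<noteq> {}" and dis: "A \<inter> B = {}"
    and E: "E = {{a, b} | a b. a \<in> A \<and> b \<in> B}"
    and reg: "regular_seq (A \<union> B) (edge_ideal (A \<union> B) E) fs"
  shows "length fs \<le> 1"
proof (rule ccontr)
  assume "\<not> length fs \<le> 1"
  then obtain f g gs where fs: "fs = f # g # gs"
    by (cases fs; cases "tl fs") auto
  let ?W = "A \<union> B"
  let ?I = "edge_ideal ?W E :: ('v, 'k) mpoly set"
  note I = edge_ideal_complete_bipartite[OF dis E, where ?'k = 'k]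
  have finW: "finite ?W" using fin by simp
  have idI: "is_ideal ?W ?I" unfolding I by (auto simp: is_ideal_def kill_add kill_mult)
  have f: "f \<in> polys ?W" "Poly_Mapping.lookup f 0 = 0" and g: "g \<in> polys ?W" "Poly_Mapping.lookup g 0 = 0"
    using reg fs by (auto simp: regular_seq_def max_ideal_def)
  have reg1: "h \<in> ?I" if "h \<in> polys ?W" "f * h \<in> ?I" for h
    using reg that unfolding fs regular_seq_def
    by (auto simp: ideal_gen_ideal[OF idI] dest!: spec[of _ 0])
  have reg2: "h \<in> ideal_gen ?W (?I \<union> {f})" if "h \<in> polys ?W" "g * h \<in> ideal_gen ?W (?I \<union> {f})" for h
    using reg that unfolding fs regular_seq_def by (auto dest!: spec[of _ "Suc 0"])
  \<comment> \<open>Without constant term every monomial involves a variable from \<open>A\<close>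
    or \<open>B\<close>, so nothing survives both substitutions.\<close>
  have kAB: "kill A (kill B p) = 0" "kill B (kill A p) = 0"
    if p: "p \<in> polys ?W" "Poly_Mapping.lookup p 0 = 0" for p :: "('v, 'k) mpoly"
  proof -
    have "Poly_Mapping.keys m \<inter> ?W \<noteq> {}" if "m \<in> Poly_Mapping.keys p" for m
    proof -
      have "m \<noteq> 0" using that p(2) by (auto simp: in_keys_iff)
      then have "Poly_Mapping.keys m \<noteq> {}" by (metis in_keys_iff empty_iff poly_mapping_eqI lookup_zero)
      then show ?thesis using p(1) that unfolding polys_def by blast
    qed
    then show "kill A (kill B p) = 0" "kill B (kill A p) = 0"
      by (simp_all add: kill_kill kill_eq_0_iff Un_commute)
  qed
  let ?a = "kill B f" and ?b = "kill A f"
  \<comment> \<open>If \<open>f\<close> had no part purely in the variables of \<open>B\<close>, it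
    would multiply each such variable into the edge ideal, contradicting regularity. The case of
    \<open>?a\<close> is symmetric.\<close>
  have b0: "?b \<noteq> 0"
  proof
    assume b: "?b = 0"
    obtain y where y: "y \<in> B" using ne by auto
    have "Var y \<in> ?I" by (rule reg1) (use y f b in \<open>auto simp: I kill_mult kill_Var\<close>)
    moreover have "y \<notin> A" using y dis by auto
    ultimately show False by (simp add: I kill_Var)
  qed
  have a0: "?a \<noteq> 0"
  proof
    assume a: "?a = 0"
    obtain x where x: "x \<in> A" using ne by auto
    have "Var x \<in> ?I" by (rule reg1) (use x f a in \<open>auto simp: I kill_mult kill_Var\<close>)
    moreover have "x \<notin> B" using x dis by auto
    ultimately show False by (simp add: I kill_Var)
  qed
  have aW: "?a \<in> polys ?W" using f by auto
  \<comment> \<open>The socle relation: modulo \<open>A\<close> both products vanish since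
    \<open>f\<close> and \<open>g\<close> have no constant term, and modulo \<open>B\<close> they
    agree.\<close>
  have "g * ?a - kill B g * f \<in> ?I"
    using f g by (auto simp: I kill_diff kill_mult kAB)
  then have "g * ?a \<in> ideal_gen ?W (?I \<union> {f})"
    unfolding ideal_gen_insert_ideal[OF idI f(1)] using kill_polys[OF g(1), of B]
    by (metis (mono_tags, lifting) diff_add_cancel mem_Collect_eq)
  then have "?a \<in> ideal_gen ?W (?I \<union> {f})" using reg2 aW by blast
  then obtain i h where ih: "?a = i + h * f" "i \<in> ?I" "h \<in> polys ?W"
    unfolding ideal_gen_insert_ideal[OF idI f(1)] by blast
  \<comment> \<open>Evaluating the equation for \<open>?a\<close> modulo \<open>A\<close> forces h
    to vanish there; evaluating it modulo \<open>B\<close> forces h to be 1 there. Killing all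
    variables then shows that the constant term of h is both 0 and 1.\<close>
  have "kill A h * ?b = 0"
    using arg_cong[OF ih(1), of "kill A"] ih(2) f by (simp add: I kill_add kill_mult kAB)
  then have hA: "kill A h = 0"
    using polys_no_zero_divisors[OF finW kill_polys[OF ih(3)] kill_polys[OF f(1)]] b0 by blast
  have "?a = kill B h * ?a"
    using arg_cong[OF ih(1), of "kill B"] ih(2) by (simp add: I kill_add kill_mult kill_kill)
  then have "(kill B h - 1) * ?a = 0" by (simp add: algebra_simps)
  moreover have "kill B h - 1 \<in> polys ?W" using ih(3) by auto
  ultimately have hB: "kill B h = 1"
    using polys_no_zero_divisors[OF finW _ aW] a0 by force
  have "kill A (kill B h) = kill B (kill A h)" by (simp add: kill_kill Un_commute)
  then show False using hA hB by simp
qed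

text \<open>Depth is at most 1 by the bound on regular sequences, whereas two vertices in
  \<open>A\<close> allow a chain of primes of length 2 above the edge ideal.\<close>

lemma complete_bipartite_not_cohen_macaulay:
  fixes A B :: "'v set"
  assumes fin: "finite A" "finite B" and cA: "2 \<le> card A" and ne: "B \<noteq> {}" and dis: "A \<inter> B = {}"
    and E: "E = {{a, b} | a b. a \<in> A \<and> b \<in> B}"
  shows "\<not> cohen_macaulay_graph TYPE('k::field) (A \<union> B) E"
proof
  let ?W = "A \<union> B"
  let ?I = "edge_ideal ?W E :: ('v, 'k) mpoly set"
  assume "cohen_macaulay_graph TYPE('k::field) (A \<union> B) E"
  then have eq: "depth ?W ?I = krull_dim ?W ?I"
    by (simp add: cohen_macaulay_graph_def cohen_macaulay_quot_def)
  have "A \<noteq> {}" using cA by auto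
  then have "depth ?W ?I \<le> enat 1"
    unfolding depth_def
    by (intro Sup_least) (use regular_seq_complete_bipartite[OF fin _ ne dis E, where ?'k = 'k] in auto)
  moreover have "enat 2 \<le> krull_dim ?W ?I"
  proof -
    obtain x where x: "x \<in> A" using cA by fastforce
    obtain y where y: "y \<in> A" "x \<noteq> y"
      using cA x by (metis card_le_Suc0_iff_eq fin(1) not_less_eq_eq numeral_2_eq_2)
    have xyB: "x \<notin> B" "y \<notin> B" using x y dis by auto
    let ?P = "\<lambda>Q. {p \<in> polys ?W. kill Q p = (0 :: ('v, 'k) mpoly)}"
    \<comment> \<open>The chain (B), (B, x), (B, x, y); it is strict because each step adds a new
      variable.\<close>
    let ?Ps = "[?P B, ?P (insert x B), ?P (insert y (insert x B))]"
    have strict: "?P Q \<subset> ?P (insert v Q)" if "v \<in> ?W" "v \<notin> Q" for v Q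
    proof
      show "?P Q \<subseteq> ?P (insert v Q)" by (auto simp: kill_eq_0_iff)
      have "Var v \<in> ?P (insert v Q)" "Var v \<notin> ?P Q" using that by (auto simp: kill_Var)
      then show "?P Q \<noteq> ?P (insert v Q)" by blast
    qed
    have "?I \<subseteq> ?P B" unfolding edge_ideal_complete_bipartite[OF dis E] by auto
    then have "\<forall>P\<in>set ?Ps. prime_ideal ?W P \<and> ?I \<subseteq> P"
      using prime_ideal_kill[of ?W] fin strict[of x B] strict[of y "insert x B"] x y xyB by auto
    moreover have "\<forall>i<2. ?Ps ! i \<subset> ?Ps ! Suc i"
      using strict[of x B] strict[of y "insert x B"] x y xyB by (simp add: less_2_cases_iff)
    moreover have "length ?Ps = Suc 2" by simp
    ultimately show ?thesis
      unfolding krull_dim_def by (intro Sup_upper) blast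
  qed
  ultimately have "enat 2 \<le> enat 1" using eq by (metis order_trans)
  then show False by simp
qed


section \<open>Linear syzygies of squarefree monomials\<close>

lemma module_span_0: "(\<lambda>_. 0) \<in> module_span W L"
  unfolding module_span_def by (auto intro!: exI[of _ "{}"])

lemma module_span_base: "w \<in> L \<Longrightarrow> r \<in> polys W \<Longrightarrow> (\<lambda>i. r * w i) \<in> module_span W L"
  unfolding module_span_def by (auto intro!: exI[of _ "{w}"] exI[of _ "\<lambda>_. r"])

lemma module_span_scale:
  assumes "a \<in> module_span W L" and r: "r \<in> polys W"
  shows "(\<lambda>i. r * a i) \<in> module_span W L"
proof -
  obtain F c where F: "finite F" "F \<subseteq> L" "\<forall>w\<in>F. c w \<in> polys W" "a = (\<lambda>i. \<Sum>w\<in>F. c w * w i)"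
    using assms(1) by (auto simp: module_span_def)
  have "(\<lambda>i. r * a i) = (\<lambda>i. \<Sum>w\<in>F. (r * c w) * w i)"
    by (simp add: F(4) sum_distrib_left mult.assoc)
  moreover have "\<forall>w\<in>F. r * c w \<in> polys W" using F(3) r by auto
  ultimately show ?thesis unfolding module_span_def using F(1,2)
    by (auto intro!: exI[of _ F] exI[of _ "\<lambda>w. r * c w"])
qed

lemma module_span_add:
  assumes "a \<in> module_span W L" "b \<in> module_span W L"
  shows "(\<lambda>i. a i + b i) \<in> module_span W L"
proof -
  obtain F c where F: "finite F" "F \<subseteq> L" "\<forall>w\<in>F. c w \<in> polys W" "a = (\<lambda>i. \<Sum>w\<in>F. c w * w i)"
    using assms(1) by (auto simp: module_span_def)
  obtain G d where G: "finite G" "G \<subseteq> L" "\<forall>w\<in>G. d w \<in> polys W" "b = (\<lambda>i. \<Sum>w\<in>G. d w * w i)"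
    using assms(2) by (auto simp: module_span_def)
  define e where "e w = (if w \<in> F then c w else 0) + (if w \<in> G then d w else 0)" for w
  have "(\<Sum>w\<in>F. c w * w i) = (\<Sum>w\<in>F \<union> G. (if w \<in> F then c w else 0) * w i)" for i
    using F(1) G(1) by (intro sum.mono_neutral_cong_left) auto
  moreover have "(\<Sum>w\<in>G. d w * w i) = (\<Sum>w\<in>F \<union> G. (if w \<in> G then d w else 0) * w i)" for i
    using F(1) G(1) by (intro sum.mono_neutral_cong_left) auto
  ultimately have "(\<lambda>i. a i + b i) = (\<lambda>i. \<Sum>w\<in>F \<union> G. e w * w i)"
    by (simp add: F(4) G(4) e_def distrib_right sum.distrib)
  moreover have "\<forall>w\<in>F \<union> G. e w \<in> polys W" using F(3) G(3) by (auto simp: e_def)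
  ultimately show ?thesis unfolding module_span_def using F(1,2) G(1,2)
    by (auto intro!: exI[of _ "F \<union> G"] exI[of _ e])
qed

lemma syzygies_add:
  "a \<in> syzygies W Ix u \<Longrightarrow> b \<in> syzygies W Ix u \<Longrightarrow> (\<lambda>i. a i + b i) \<in> syzygies W Ix u"
  by (auto simp: syzygies_def distrib_right sum.distrib)

lemma syzygies_scale:
  "a \<in> syzygies W Ix u \<Longrightarrow> r \<in> polys W \<Longrightarrow> (\<lambda>i. r * a i) \<in> syzygies W Ix u"
  by (auto simp: syzygies_def mult.assoc simp flip: sum_distrib_left)

lemma module_span_subset_syzygies:
  assumes "L \<subseteq> syzygies W Ix u"
  shows "module_span W L \<subseteq> syzygies W Ix u"
proof
  fix a assume "a \<in> module_span W L"
  then obtain F c where F: "finite F" "F \<subseteq> L" "\<forall>w\<in>F. c w \<in> polys W" "a = (\<lambda>i. \<Sum>w\<in>F. c w * w i)"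
    by (auto simp: module_span_def)
  have "(\<lambda>i. \<Sum>w\<in>F. c w * w i) \<in> syzygies W Ix u"
    using F(1-3)
  proof (induction F rule: finite_induct)
    case empty
    show ?case by (simp add: syzygies_def)
  next
    case (insert w F)
    have "(\<lambda>i. c w * w i) \<in> syzygies W Ix u" using insert.prems assms by (auto intro: syzygies_scale)
    from syzygies_add[OF this insert.IH] insert show ?case by simp
  qed
  then show "a \<in> syzygies W Ix u" using F(4) by simp
qed

section \<open>Binomial syzygies and exchange chains\<close>

text \<open>The two-term vector m e_i - n e_j. As a difference of two conditionals it also makes
  sense for i = j, and consecutive vectors along a chain telescope entrywise.\<close>

definition binom_vec :: "'i \<Rightarrow> ('v \<Rightarrow>\<^sub>0 nat) \<Rightarrow> 'i \<Rightarrow> ('v \<Rightarrow>\<^sub>0 nat) \<Rightarrow> 'i \<Rightarrow> ('v, 'k::field) mpoly" where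
  "binom_vec i m j n k = (if k = i then Poly_Mapping.single m 1 else 0) - (if k = j then Poly_Mapping.single n 1 else 0)"

text \<open>The bound \<open>U\<close> confines the sets of a chain: with \<open>U\<close> the union
  of the endpoints, every intermediate squarefree monomial divides the lcm of the two outer
  ones.\<close>

definition exchange_step :: "'v set set \<Rightarrow> 'v set \<Rightarrow> 'v set \<Rightarrow> 'v set \<Rightarrow> bool" where
  "exchange_step \<F> U C D \<longleftrightarrow> C \<in> \<F> \<and> D \<in> \<F> \<and> C \<subseteq> U \<and> D \<subseteq> U \<and> card (C - D) = 1 \<and> card (D - C) = 1"

abbreviation exchange_connected :: "'v set set \<Rightarrow> 'v set \<Rightarrow> 'v set \<Rightarrow> bool" where
  "exchange_connected \<F> C D \<equiv> (exchange_step \<F> (C \<union> D))\<^sup>*\<^sup>* C D"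

lemma exchange_steps_mono:
  assumes "(exchange_step \<F> U)\<^sup>*\<^sup>* C D" "U \<subseteq> U'"
  shows "(exchange_step \<F> U')\<^sup>*\<^sup>* C D"
proof -
  have "exchange_step \<F> U \<le> exchange_step \<F> U'" using assms(2) unfolding exchange_step_def by (intro predicate2I) blast
  then show ?thesis using assms(1) rtranclp_mono by blast
qed

context
  fixes V :: "'v set" and \<F> :: "'v set set"
  assumes finV: "finite V" and \<F>V: "\<F> \<subseteq> Pow V"
begin

private definition u :: "'v set \<Rightarrow> ('v, 'k::field) mpoly" where
  "u C = (\<Prod>t\<in>C. Var t)"

text \<open>All syzygies with linear entries are taken at once, the largest possible candidate for a
  linear generating set, so no generators have to be chosen.\<close>

private definition linear_syzygies :: "('v set \<Rightarrow> ('v, 'k::field) mpoly) set" where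
  "linear_syzygies = {w \<in> syzygies V \<F> u. \<forall>C. linear_form (w C)}"

private lemma finite_mem: "C \<in> \<F> \<Longrightarrow> finite C"
  using finV \<F>V finite_subset by blast

private lemma finite_family: "finite \<F>"
  using finV \<F>V finite_subset by blast

private lemma u_eq: "C \<in> \<F> \<Longrightarrow> u C = Poly_Mapping.single (monom_of C) 1"
  unfolding u_def by (rule prod_Var_eq[OF finite_mem])

private lemma binom_vec_syzygy:
  assumes C: "C \<in> \<F>" and D: "D \<in> \<F>" and eq: "m + monom_of C = n + monom_of D"
    and mV: "Poly_Mapping.keys m \<subseteq> V" and nV: "Poly_Mapping.keys n \<subseteq> V"
  shows "(binom_vec C m D n :: _ \<Rightarrow> ('v, 'k::field) mpoly) \<in> syzygies V \<F> u"
proof -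
  have "(\<Sum>k\<in>\<F>. binom_vec C m D n k * u k) =
      (\<Sum>k\<in>\<F>. if k = C then Poly_Mapping.single m 1 * u k else 0)
      - (\<Sum>k\<in>\<F>. if k = D then Poly_Mapping.single n 1 * (u k :: ('v, 'k) mpoly) else 0)"
    unfolding sum_subtractf[symmetric] by (rule sum.cong) (auto simp: binom_vec_def left_diff_distrib)
  also have "\<dots> = 0"
    using C D eq finite_family by (simp add: u_eq mult_single)
  finally show ?thesis
    using C D mV nV by (auto simp: syzygies_def binom_vec_def)
qed

text \<open>With C = K + s and D = K + t, the vector t e_C - s e_D is a linear syzygy, both products
  being the monomial of \<open>C \<union> D\<close>. Multiplying it by the cofactor of that monomial
  in \<open>\<mu>\<close> gives the vector claimed.\<close>

private lemma binom_vec_step: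
  assumes step: "exchange_step \<F> U C D" and UV: "U \<subseteq> Poly_Mapping.keys \<mu>" and \<mu>: "Poly_Mapping.keys \<mu> \<subseteq> V"
  shows "(binom_vec C (\<mu> - monom_of C) D (\<mu> - monom_of D) :: _ \<Rightarrow> ('v, 'k::field) mpoly)
    \<in> module_span V linear_syzygies"
proof -
  have CD: "C \<in> \<F>" "D \<in> \<F>" "C \<subseteq> U" "D \<subseteq> U" using step by (auto simp: exchange_step_def)
  obtain s where s: "C - D = {s}" using step by (auto simp: exchange_step_def card_1_singleton_iff)
  obtain t where t: "D - C = {t}" using step by (auto simp: exchange_step_def card_1_singleton_iff)
  have fin: "finite C" "finite D" using CD finite_mem by auto
  define K where "K = C \<inter> D"
  have K: "C = insert s K" "D = insert t K" "s \<notin> K" "t \<notin> K" "s \<noteq> t" and finK: "finite K"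
    using s t fin unfolding K_def by (blast, blast, blast, blast, blast, blast)
  define w :: "'v set \<Rightarrow> ('v, 'k) mpoly" where
    "w = binom_vec C (Poly_Mapping.single t 1) D (Poly_Mapping.single s 1)"
  \<comment> \<open>The cofactor of the lcm in \<open>\<mu>\<close>. The subtraction is exact since
    \<open>C \<union> D\<close> lies in the support of \<open>\<mu>\<close>.\<close>
  define \<nu> where "\<nu> = \<mu> - monom_of (C \<union> D)"
  have neq: "C \<noteq> D" using s by auto
  have "Poly_Mapping.single t 1 + monom_of C = Poly_Mapping.single s 1 + monom_of D"
    using finK K(3-5) by (intro poly_mapping_eqI)
      (auto simp: K(1,2) lookup_add lookup_single lookup_monom_of when_def)
  moreover have "s \<in> V" "t \<in> V" using K(1,2) CD(1,2) \<F>V by blast+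
  ultimately have "w \<in> syzygies V \<F> u"
    unfolding w_def using CD by (intro binom_vec_syzygy) auto
  moreover have "linear_form (w k)" for k
    using neq by (auto simp: linear_form_def w_def binom_vec_def total_deg_def)
  ultimately have "w \<in> linear_syzygies" by (simp add: linear_syzygies_def)
  moreover have "Poly_Mapping.single \<nu> 1 \<in> (polys V :: ('v, 'k) mpoly set)"
    using \<mu> by (intro polys_single) (auto simp: \<nu>_def in_keys_iff lookup_minus)
  ultimately have "(\<lambda>k. Poly_Mapping.single \<nu> 1 * w k) \<in> module_span V linear_syzygies"
    by (rule module_span_base)
  moreover have "\<mu> - monom_of C = \<nu> + Poly_Mapping.single t 1"
  proof (rule poly_mapping_eqI)
    fix x
    have "x \<in> D \<Longrightarrow> Poly_Mapping.lookup \<mu> x \<ge> 1" using UV CD by (force simp: in_keys_iff)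
    then show "Poly_Mapping.lookup (\<mu> - monom_of C) x = Poly_Mapping.lookup (\<nu> + Poly_Mapping.single t 1) x"
      using finK K(3-5) by (auto simp: K(1,2) \<nu>_def lookup_add lookup_minus lookup_single lookup_monom_of when_def)
  qed
  moreover have "\<mu> - monom_of D = \<nu> + Poly_Mapping.single s 1"
  proof (rule poly_mapping_eqI)
    fix x
    have "x \<in> C \<Longrightarrow> Poly_Mapping.lookup \<mu> x \<ge> 1" using UV CD by (force simp: in_keys_iff)
    then show "Poly_Mapping.lookup (\<mu> - monom_of D) x = Poly_Mapping.lookup (\<nu> + Poly_Mapping.single s 1) x"
      using finK K(3-5) by (auto simp: K(1,2) \<nu>_def lookup_add lookup_minus lookup_single lookup_monom_of when_def)
  qed
  moreover have "binom_vec C (\<nu> + Poly_Mapping.single t 1) D (\<nu> + Poly_Mapping.single s 1) =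
      (\<lambda>k. Poly_Mapping.single \<nu> 1 * w k)"
    by (rule ext) (auto simp: w_def binom_vec_def right_diff_distrib mult_single)
  ultimately show ?thesis by simp
qed

text \<open>All sets of the chain lie in the support of the common multiple \<open>\<mu>\<close>, so
  the vectors of its single steps, each scaled to \<open>\<mu>\<close>, telescope to the vector
  joining the endpoints.\<close>

private lemma binom_vec_in_span:
  assumes conn: "exchange_connected \<F> C D"
    and eq: "m + monom_of C = n + monom_of D"
    and C: "C \<in> \<F>" and D: "D \<in> \<F>" and mV: "Poly_Mapping.keys m \<subseteq> V"
  shows "(binom_vec C m D n :: _ \<Rightarrow> ('v, 'k::field) mpoly) \<in> module_span V linear_syzygies"
proof -
  define \<mu> where "\<mu> = m + monom_of C"
  have fin: "finite C" "finite D" using C D finite_mem by auto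
  have U: "C \<union> D \<subseteq> Poly_Mapping.keys \<mu>"
    using eq fin unfolding \<mu>_def by (metis Un_least Un_upper2 keys_add_nat keys_monom_of)
  have \<mu>V: "Poly_Mapping.keys \<mu> \<subseteq> V"
    using mV C \<F>V fin by (auto simp: \<mu>_def keys_add_nat keys_monom_of)
  have "(binom_vec C (\<mu> - monom_of C) D (\<mu> - monom_of D) :: _ \<Rightarrow> ('v, 'k) mpoly)
      \<in> module_span V linear_syzygies"
    using conn
  proof (induction rule: rtranclp_induct)
    case base
    have "binom_vec C (\<mu> - monom_of C) C (\<mu> - monom_of C) = (\<lambda>_. 0 :: ('v, 'k) mpoly)"
      by (auto simp: binom_vec_def)
    then show ?case using module_span_0[of V linear_syzygies] by simp
  next
    case (step D D')
    have "(binom_vec C (\<mu> - monom_of C) D' (\<mu> - monom_of D') :: _ \<Rightarrow> ('v, 'k) mpoly) =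
      (\<lambda>k. binom_vec C (\<mu> - monom_of C) D (\<mu> - monom_of D) k
        + binom_vec D (\<mu> - monom_of D) D' (\<mu> - monom_of D') k)"
      by (rule ext) (simp add: binom_vec_def)
    then show ?case
      using module_span_add[OF step.IH binom_vec_step[OF step.hyps(2) U \<mu>V]] by simp
  qed
  moreover have "\<mu> - monom_of C = m" "\<mu> - monom_of D = n"
    by (simp_all add: \<mu>_def) (simp add: eq)
  ultimately show ?thesis by simp
qed

text \<open>Subtracting a binomial syzygy shared by two entries cancels a term of one entry without
  creating a new one in the other, so every syzygy reduces to 0.\<close>

private lemma syzygy_in_span:
  assumes conn: "\<And>C D. C \<in> \<F> \<Longrightarrow> D \<in> \<F> \<Longrightarrow> exchange_connected \<F> C D"
    and "(a :: _ \<Rightarrow> ('v, 'k::field) mpoly) \<in> syzygies V \<F> u"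
  shows "a \<in> module_span V linear_syzygies"
  using assms(2)
proof (induction "\<Sum>C\<in>\<F>. card (Poly_Mapping.keys (a C))" arbitrary: a rule: less_induct)
  case less
  note a = less.prems
  show ?case
  proof (cases "a = (\<lambda>_. 0)")
    case True
    then show ?thesis by (simp add: module_span_0)
  next
    case False
    then obtain C where "a C \<noteq> 0" by auto
    then obtain m where m: "m \<in> Poly_Mapping.keys (a C)"
      by (metis in_keys_iff poly_mapping_eqI lookup_zero)
    have C: "C \<in> \<F>" using a \<open>a C \<noteq> 0\<close> by (auto simp: syzygies_def)
    define \<mu> where "\<mu> = m + monom_of C"
    \<comment> \<open>The contribution of position \<open>D\<close> to the coefficient of
      \<open>\<mu>\<close> in the vanishing sum. Position \<open>C\<close> contributes a nonzero
      amount, so some other \<open>D\<close> must as well, which yields the partner term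
      \<open>n\<close>.\<close>
    define f where "f D = Poly_Mapping.lookup (a D * u D) \<mu>" for D
    have shift: "Poly_Mapping.lookup (p * Poly_Mapping.single n 1) (k + n) = Poly_Mapping.lookup p k"
      for p :: "('v, 'k) mpoly" and n k
    proof -
      have "p * Poly_Mapping.single n 1 =
          (\<Sum>l\<in>Poly_Mapping.keys p. Poly_Mapping.single (l + n) (Poly_Mapping.lookup p l))"
        by (subst poly_mapping_sum_singles[of p]) (simp add: sum_distrib_right mult_single)
      then show ?thesis
        by (simp add: lookup_sum lookup_single when_def in_keys_iff)
    qed
    have "f C \<noteq> 0" using m C by (simp add: f_def \<mu>_def u_eq shift in_keys_iff)
    moreover have "sum f \<F> = 0"
      using a by (simp add: f_def syzygies_def flip: lookup_sum)
    then have "f C + sum f (\<F> - {C}) = 0" using C finite_family by (metis sum.remove)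
    ultimately have "sum f (\<F> - {C}) \<noteq> 0" by auto
    then obtain D where D: "D \<in> \<F>" "D \<noteq> C" "f D \<noteq> 0"
      by (metis DiffE insertI1 sum.neutral)
    then have "\<mu> \<in> Poly_Mapping.keys (a D * Poly_Mapping.single (monom_of D) 1)"
      by (simp add: f_def u_eq in_keys_iff)
    then obtain n where n: "n \<in> Poly_Mapping.keys (a D)" "\<mu> = n + monom_of D"
      using keys_mult[of "a D" "Poly_Mapping.single (monom_of D) 1"] by auto
    have mV: "Poly_Mapping.keys m \<subseteq> V" and nV: "Poly_Mapping.keys n \<subseteq> V"
      using a m n by (auto simp: syzygies_def polys_def)
    have eq: "m + monom_of C = n + monom_of D" using n(2) by (simp add: \<mu>_def)
    define c where "c = Poly_Mapping.lookup (a C) m"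
    define b where "b k = Poly_Mapping.single 0 c * binom_vec C m D n k" for k
    \<comment> \<open>Subtraction is written as adding a multiple by -1 so that closure of syzygies
      under sums and multiples applies directly.\<close>
    define a' where "a' k = a k + (- 1) * b k" for k
    have c_poly: "Poly_Mapping.single 0 c \<in> (polys V :: ('v, 'k) mpoly set)" by auto
    have "(- 1 :: ('v, 'k) mpoly) \<in> polys V" by auto
    then have a'_syz: "a' \<in> syzygies V \<F> u"
      unfolding a'_def b_def
      by (intro syzygies_add[OF a] syzygies_scale c_poly binom_vec_syzygy C D(1) eq mV nV)
    have a'C: "a' C = a C - Poly_Mapping.single m c"
      using D by (simp add: a'_def b_def binom_vec_def mult_single)
    have a'D: "a' D = a D + Poly_Mapping.single n c"
      using D by (simp add: a'_def b_def binom_vec_def mult_single)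
    have a'k: "a' k = a k" if "k \<noteq> C" "k \<noteq> D" for k
      using that by (simp add: a'_def b_def binom_vec_def)
    have keysC: "Poly_Mapping.keys (a' C) \<subseteq> Poly_Mapping.keys (a C) - {m}"
      by (auto simp: a'C in_keys_iff lookup_minus lookup_single when_def c_def split: if_splits)
    have keysD: "Poly_Mapping.keys (a' D) \<subseteq> Poly_Mapping.keys (a D)"
      using n(1) by (auto simp: a'D in_keys_iff lookup_add lookup_single when_def split: if_splits)
    have "card (Poly_Mapping.keys (a' C)) < card (Poly_Mapping.keys (a C))"
      using keysC m by (intro psubset_card_mono) auto
    moreover have "card (Poly_Mapping.keys (a' k)) \<le> card (Poly_Mapping.keys (a k))" for k
      using keysC keysD a'k[of k] by (cases "k = C"; cases "k = D") (auto intro!: card_mono)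
    ultimately have "(\<Sum>C\<in>\<F>. card (Poly_Mapping.keys (a' C))) < (\<Sum>C\<in>\<F>. card (Poly_Mapping.keys (a C)))"
      using C finite_family by (intro sum_strict_mono_ex1) auto
    then have "a' \<in> module_span V linear_syzygies" using less.hyps a'_syz by blast
    moreover have "b \<in> module_span V linear_syzygies"
      unfolding b_def
      by (intro module_span_scale c_poly binom_vec_in_span conn C D(1) eq mV)
    ultimately have "(\<lambda>k. a' k + b k) \<in> module_span V linear_syzygies" by (rule module_span_add)
    then show ?thesis by (simp add: a'_def)
  qed
qed

text \<open>Equal cardinality puts all generators in one degree; connectivity makes the linear
  syzygies span all syzygies. Used contrapositively to find a pair that no chain joins.\<close>

lemma linearly_presented_if_exchange_connected:
  assumes card: "\<And>C. C \<in> \<F> \<Longrightarrow> card C = d"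
    and conn: "\<And>C D. C \<in> \<F> \<Longrightarrow> D \<in> \<F> \<Longrightarrow> exchange_connected \<F> C D"
  shows "linearly_presented V \<F> (\<lambda>C. (\<Prod>t\<in>C. Var t) :: ('v, 'k::field) mpoly)"
proof -
  have "homogeneous_of_deg d (u C :: ('v, 'k) mpoly) \<and> (u C :: ('v, 'k) mpoly) \<noteq> 0" if "C \<in> \<F>" for C
  proof -
    have "(u C :: ('v, 'k) mpoly) \<noteq> 0"
      using that by (metis u_eq lookup_single_eq lookup_zero zero_neq_one)
    then show ?thesis
      using that by (auto simp: u_eq homogeneous_of_deg_def total_deg_monom_of finite_mem card)
  qed
  moreover have "linear_syzygies \<subseteq> syzygies V \<F> (u :: _ \<Rightarrow> ('v, 'k) mpoly)"
    by (auto simp: linear_syzygies_def)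
  moreover from this have "syzygies V \<F> (u :: _ \<Rightarrow> ('v, 'k) mpoly) = module_span V linear_syzygies"
    using module_span_subset_syzygies syzygy_in_span[OF conn] by blast
  moreover have "\<forall>w\<in>linear_syzygies. \<forall>C. linear_form (w C :: ('v, 'k) mpoly)"
    by (auto simp: linear_syzygies_def)
  ultimately have "linearly_presented V \<F> (u :: _ \<Rightarrow> ('v, 'k) mpoly)"
    unfolding linearly_presented_def by blast
  then show ?thesis unfolding u_def[abs_def] .
qed

end

section \<open>Pairs of minimal vertex covers\<close>

lemma min_vertex_cover_subset:
  assumes "finite V" "vertex_cover V E X"
  obtains C where "min_vertex_cover V E C" "C \<subseteq> X"
proof -
  have "finite X" using assms finite_subset by (auto simp: vertex_cover_def)
  then have "\<exists>C. min_vertex_cover V E C \<and> C \<subseteq> X" using assms(2)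
  proof (induction X rule: finite_psubset_induct)
    case (psubset X)
    show ?case
    proof (cases "\<exists>D. D \<subset> X \<and> vertex_cover V E D")
      case True then show ?thesis using psubset.IH by (meson psubset_imp_subset subset_trans)
    next
      case False then show ?thesis using psubset.prems unfolding min_vertex_cover_def by blast
    qed
  qed
  then show ?thesis using that by blast
qed

text \<open>A set missing one vertex on each side leaves the edge between them uncovered. So a cover
  contains a whole side, which is itself a cover, and minimality gives equality.\<close>

lemma complete_bipartite_min_vertex_cover:
  assumes M: "min_vertex_cover (A \<union> B) {{a, b} | a b. a \<in> A \<and> b \<in> B} M"
  shows "M = A \<or> M = B"
proof -
  let ?E = "{{a, b} | a b. a \<in> A \<and> b \<in> B}"
  have cov: "vertex_cover (A \<union> B) ?E A" "vertex_cover (A \<union> B) ?E B"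
    by (auto simp: vertex_cover_def)
  have "{a, b} \<inter> M \<noteq> {}" if "a \<in> A" "b \<in> B" for a b
    using M that unfolding min_vertex_cover_def vertex_cover_def by blast
  then have "A \<subseteq> M \<or> B \<subseteq> M" by blast
  then show ?thesis using M cov unfolding min_vertex_cover_def by blast
qed

text \<open>If a minimal cover inside \<open>C1 \<union> C2\<close> omitted a vertex on each side of the symmetric difference, it
  would be closer to both \<open>C1\<close> and \<open>C2\<close> and link them by minimality.\<close>

lemma closest_disconnected_covers:
  assumes fin: "finite V" and \<F>: "\<F> \<subseteq> Pow V" and card: "\<And>C. C \<in> \<F> \<Longrightarrow> card C = d"
    and C1: "C1 \<in> \<F>" and C2: "C2 \<in> \<F>" and disc: "\<not> exchange_connected \<F> C1 C2"
    and least: "\<And>C D. C \<in> \<F> \<Longrightarrow> D \<in> \<F> \<Longrightarrow> card (C - D) < card (C1 - C2) \<Longrightarrow> exchange_connected \<F> C D"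
    and C: "C \<in> \<F>" "C \<subseteq> C1 \<union> C2"
  shows "C1 - C2 \<subseteq> C \<or> C2 - C1 \<subseteq> C"
proof (rule ccontr)
  assume neg: "\<not> ?thesis"
  have finite_mem: "finite X" if "X \<in> \<F>" for X using that fin \<F> finite_subset by blast
  \<comment> \<open>Equal cardinalities make the distance |X - Y| symmetric, so \<open>least\<close>
    can be used whichever difference is estimated.\<close>
  have sym: "card (X - Y) = card (Y - X)" if "X \<in> \<F>" "Y \<in> \<F>" for X Y
    using that by (metis card card_le_sym_Diff finite_mem le_antisym order_refl)
  \<comment> \<open>\<open>C\<close> minus \<open>C1\<close> lies in \<open>C2 - C1\<close>,
    properly because \<open>C\<close> omits a vertex there; the estimate against \<open>C2\<close>
    is the mirror image.\<close>
  have "card (C - C1) < card (C2 - C1)"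
    using neg C(2) finite_mem[OF C2] by (intro psubset_card_mono) auto
  then have "card (C1 - C) < card (C1 - C2)" using sym C1 C2 C(1) by simp
  then have 1: "exchange_connected \<F> C1 C" using least C1 C(1) by blast
  have "card (C - C2) < card (C1 - C2)"
    using neg C(2) finite_mem[OF C1] by (intro psubset_card_mono) auto
  then have 2: "exchange_connected \<F> C C2" using least C2 C(1) by blast
  have "C1 \<union> C \<subseteq> C1 \<union> C2" "C \<union> C2 \<subseteq> C1 \<union> C2" using C(2) by auto
  then have "exchange_connected \<F> C1 C2"
    using exchange_steps_mono[OF 1] exchange_steps_mono[OF 2] rtranclp_trans by metis
  then show False using disc by simp
qed

theorem theorem5p12:
  fixes V :: "'v set" and E :: "'v set set"
  assumes "simple_graph V E"
    and "unmixed V E"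
    and "\<not> cover_ideal_linearly_presented TYPE('k::field) V E"
  shows "\<exists>C1 C2. min_vertex_cover V E C1 \<and> min_vertex_cover V E C2 \<and> C1 \<noteq> C2 \<and>
           (let L = (C1 - C2) \<union> (C2 - C1); E' = induced_edges E L in
              unmixed L E' \<and> bipartite L E' \<and> no_isolated_vertices L E' \<and>
              \<not> cohen_macaulay_graph TYPE('k) L E')"
proof -
  define \<F> where "\<F> = {C. min_vertex_cover V E C}"
  have finV: "finite V" using assms(1) by (simp add: simple_graph_def)
  have \<F>V: "\<F> \<subseteq> Pow V" by (auto simp: \<F>_def min_vertex_cover_def vertex_cover_def)
  obtain d where card: "\<And>C. C \<in> \<F> \<Longrightarrow> card C = d"
    using assms(2) unfolding unmixed_def \<F>_def by (metis mem_Collect_eq)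
  \<comment> \<open>Phrased on pairs so that a disconnected pair at least distance can be picked in
    one go.\<close>
  define disc where "disc = (\<lambda>(C, D). C \<in> \<F> \<and> D \<in> \<F> \<and> \<not> exchange_connected \<F> C D)"
  have "\<exists>X. disc X"
  proof (rule ccontr)
    assume "\<nexists>X. disc X"
    then have "exchange_connected \<F> C D" if "C \<in> \<F>" "D \<in> \<F>" for C D
      using that by (auto simp: disc_def)
    then have "linearly_presented V \<F> (\<lambda>C. (\<Prod>t\<in>C. Var t) :: ('v, 'k) mpoly)"
      using linearly_presented_if_exchange_connected[OF finV \<F>V card] by blast
    then show False using assms(3) by (simp add: cover_ideal_linearly_presented_def \<F>_def)
  qed
  then obtain X where X: "disc X" "\<forall>Y. disc Y \<longrightarrow> card (fst X - snd X) \<le> card (fst Y - snd Y)"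
    using ex_has_least_nat[of disc _ "\<lambda>X. card (fst X - snd X)"] by blast
  obtain C1 C2 where X_eq: "X = (C1, C2)" by fastforce
  have C1: "C1 \<in> \<F>" and C2: "C2 \<in> \<F>" and disc12: "\<not> exchange_connected \<F> C1 C2"
    using X(1) by (auto simp: X_eq disc_def)
  have least: "exchange_connected \<F> C D" if "C \<in> \<F>" "D \<in> \<F>" "card (C - D) < card (C1 - C2)" for C D
    using X(2)[rule_format, of "(C, D)"] that by (force simp: X_eq disc_def)
  have fin: "finite C1" "finite C2" using C1 C2 finV \<F>V finite_subset by blast+
  define A B where "A = C1 - C2" and "B = C2 - C1"
  have finAB: "finite A" "finite B" using fin by (auto simp: A_def B_def)
  have dis: "A \<inter> B = {}" by (auto simp: A_def B_def)
  have cardAB: "card A = card B"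
    unfolding A_def B_def using card C1 C2 fin by (metis card_le_sym_Diff le_antisym order_refl)
  have neq: "C1 \<noteq> C2" using disc12 by auto
  have "card A \<noteq> 0"
  proof
    assume "card A = 0"
    then have "A = {}" "B = {}" using cardAB finAB by auto
    then show False using neq by (auto simp: A_def B_def)
  qed
  \<comment> \<open>At distance one the two covers would be joined by a single exchange.\<close>
  moreover have "card A \<noteq> 1"
  proof
    assume "card A = 1"
    then have "exchange_step \<F> (C1 \<union> C2) C1 C2"
      using cardAB C1 C2 by (auto simp: exchange_step_def A_def B_def)
    then show False using disc12 by blast
  qed
  ultimately have cA: "2 \<le> card A" by linarith
  then have ne: "A \<noteq> {}" "B \<noteq> {}" using cardAB by auto
  have cov: "e \<inter> C1 \<noteq> {}" "e \<inter> C2 \<noteq> {}" if "e \<in> E" for e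
    using that C1 C2 by (auto simp: \<F>_def min_vertex_cover_def vertex_cover_def)
  \<comment> \<open>For a non-edge ab, the union of the two covers stays a cover after removing
    \<open>a\<close> and \<open>b\<close>. A minimal cover inside it omits a vertex on each side,
    which \<open>closest_disconnected_covers\<close> excludes.\<close>
  have joined: "{a, b} \<in> E" if ab: "a \<in> A" "b \<in> B" for a b
  proof (rule ccontr)
    assume nE: "{a, b} \<notin> E"
    have "vertex_cover V E (C1 \<union> C2 - {a, b})"
      unfolding vertex_cover_def
    proof (intro conjI ballI notI)
      show "C1 \<union> C2 - {a, b} \<subseteq> V" using C1 C2 \<F>V by auto
      fix e assume e: "e \<in> E" "e \<inter> (C1 \<union> C2 - {a, b}) = {}"
      \<comment> \<open>The edge must meet \<open>C1\<close> and \<open>C2\<close>, but only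
        \<open>a\<close> and \<open>b\<close> are available, and each of them lies in just one of
        the two covers.\<close>
      have "a \<in> e" "b \<in> e" using cov[OF e(1)] e(2) ab by (auto simp: A_def B_def)
      moreover have "a \<noteq> b" using ab dis by blast
      moreover have "card e = 2" using assms(1) e(1) by (auto simp: simple_graph_def)
      ultimately have "e = {a, b}" by (auto simp: card_2_iff)
      then show False using nE e(1) by simp
    qed
    then obtain C where C: "min_vertex_cover V E C" "C \<subseteq> C1 \<union> C2 - {a, b}"
      using min_vertex_cover_subset[OF finV] by blast
    then have "C1 - C2 \<subseteq> C \<or> C2 - C1 \<subseteq> C"
      by (intro closest_disconnected_covers[OF finV \<F>V card C1 C2 disc12 least]) (auto simp: \<F>_def)
    then show False using C(2) ab by (auto simp: A_def B_def)
  qed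
  \<comment> \<open>An edge inside the symmetric difference meets \<open>C1\<close> only in
    \<open>A\<close> and \<open>C2\<close> only in \<open>B\<close>; as both covers meet it, it runs
    between the sides.\<close>
  have E': "induced_edges E (A \<union> B) = {{a, b} | a b. a \<in> A \<and> b \<in> B}"
  proof (intro equalityI subsetI)
    fix e assume "e \<in> induced_edges E (A \<union> B)"
    then have e: "e \<in> E" "e \<subseteq> A \<union> B" by (auto simp: induced_edges_def)
    obtain a where a: "a \<in> e" "a \<in> A" using cov(1)[OF e(1)] e(2) by (auto simp: B_def)
    obtain b where b: "b \<in> e" "b \<in> B" using cov(2)[OF e(1)] e(2) by (auto simp: A_def)
    have "a \<noteq> b" using a b dis by auto
    moreover have "card e = 2" using assms(1) e(1) by (auto simp: simple_graph_def)
    ultimately have "e = {a, b}" using a b by (auto simp: card_2_iff)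
    then show "e \<in> {{a, b} | a b. a \<in> A \<and> b \<in> B}" using a b by blast
  qed (use joined in \<open>auto simp: induced_edges_def\<close>)
  have "unmixed (A \<union> B) (induced_edges E (A \<union> B))"
    unfolding unmixed_def E'
    by (intro allI impI) (drule complete_bipartite_min_vertex_cover, drule complete_bipartite_min_vertex_cover,
      use cardAB in auto)
  moreover have "bipartite (A \<union> B) (induced_edges E (A \<union> B))"
    unfolding bipartite_def E' using dis by (intro exI[of _ A] exI[of _ B]) auto
  moreover have "no_isolated_vertices (A \<union> B) (induced_edges E (A \<union> B))"
    unfolding no_isolated_vertices_def E' using ne by blast
  moreover have "\<not> cohen_macaulay_graph TYPE('k) (A \<union> B) (induced_edges E (A \<union> B))"
    by (rule complete_bipartite_not_cohen_macaulay[OF finAB cA ne(2) dis E'])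
  ultimately show ?thesis
    using C1 C2 neq unfolding \<F>_def A_def B_def Let_def
    by (intro exI[of _ C1] exI[of _ C2]) simp
qed

end
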